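(* Let $a,b,c$ be real numbers with $4ac-b^{2}>0$. Let $(a_n,b_n,c_n)_{n\ge 0}$ be the sequence obtained from $(a_0,b_0,c_0)=(a,b,c)$ by iterating the rational Landen transformation (defined in the context). Then for every $n\ge 0$, $$\int_{-\infty}^{\infty}\frac{dx}{a_{n+1}x^{2}+b_{n+1}x+c_{n+1}}=\int_{-\infty}^{\infty}\frac{dx}{a_{n}x^{2}+b_{n}x+c_{n}}.$$
   Context: The rational Landen transformation is the recursion $$a_{n+1}=a_n\,\frac{(a_n+3c_n)^2-3b_n^2}{(3a_n+c_n)(a_n+3c_n)-b_n^2},$$ $$b_{n+1}=b_n\,\frac{3(a_n-c_n)^2-b_n^2}{(3a_n+c_n)(a_n+3c_n)-b_n^2},$$ $$c_{n+1}=c_n\,\frac{(3a_n+c_n)^2-3b_n^2}{(3a_n+c_n)(a_n+3c_n)-b_n^2},$$ with initial values $a_0=a$, $b_0=b$, $c_0=c$. *)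

theory Defs
  imports "HOL-Analysis.Analysis"
begin

(* The common denominator is positive whenever 4 * a * c - b^2 > 0, so on the triples of
   interest the convention x / 0 = 0 plays no role. *)
definition landen_denom :: "real \<Rightarrow> real \<Rightarrow> real \<Rightarrow> real" where
  "landen_denom a b c = (3 * a + c) * (a + 3 * c) - b\<^sup>2"

definition landen :: "real \<times> real \<times> real \<Rightarrow> real \<times> real \<times> real" where
  "landen = (\<lambda>(a, b, c).
     (a * (((a + 3 * c)\<^sup>2 - 3 * b\<^sup>2) / landen_denom a b c),
      b * ((3 * (a - c)\<^sup>2 - b\<^sup>2) / landen_denom a b c),
      c * (((3 * a + c)\<^sup>2 - 3 * b\<^sup>2) / landen_denom a b c)))"

end

theory Submission
  imports Defs "HOL-Real_Asymp.Real_Asymp"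
begin

text \<open>
  Completing the square shows that the integral of \<open>1 / (a x\<^sup>2 + b x + c)\<close> over the line equals
  \<open>2 \<pi> sgn a / sqrt (4 a c - b\<^sup>2)\<close> (lemma \<open>has_integral_inverse_quadratic\<close>), so it depends on the
  coefficients only through \<open>\<Delta> = 4 a c - b\<^sup>2\<close> and the sign of \<open>a\<close>. The transformation preserves
  both (lemma \<open>landen_invariants\<close>); as positivity of \<open>\<Delta>\<close> thus persists, the closed form is
  available at every step of the iteration and always has the same value.

  That \<open>\<Delta>\<close> is invariant is seen best in the coordinates \<open>u = a + c\<close> and \<open>z = (a - c) + i b\<close>, where
  \<open>\<Delta> = u\<^sup>2 - \<bar>z\<bar>\<^sup>2\<close>. The common denominator is \<open>D = 3 u\<^sup>2 + \<Delta>\<close>, and the transformation reads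
  \<open>u' = u (u\<^sup>2 + 3 \<Delta>) / D\<close> and \<open>z' = z\<^sup>3 / D\<close>. If \<open>u\<^sup>2 > \<Delta>\<close> and \<open>u = sqrt \<Delta> * coth t\<close>, the
  first formula is the tripling formula for the hyperbolic cotangent. Since \<open>\<bar>z\<bar>\<^sup>2 = u\<^sup>2 - \<Delta>\<close>, invariance amounts to
  \<open>u\<^sup>2 (u\<^sup>2 + 3 \<Delta>)\<^sup>2 - (u\<^sup>2 - \<Delta>)\<^sup>3 = \<Delta> (3 u\<^sup>2 + \<Delta>)\<^sup>2\<close>.
\<close>

lemma has_integral_inverse_quadratic_pos:
  fixes a b c :: real
  assumes disc: "4 * a * c - b\<^sup>2 > 0" and a: "a > 0"
  shows "has_bochner_integral lborel (\<lambda>x. 1 / (a * x\<^sup>2 + b * x + c)) (2 * pi / sqrt (4 * a * c - b\<^sup>2))"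
proof -
  define s where "s = sqrt (4 * a * c - b\<^sup>2)"
  have s: "s > 0" and s2: "s\<^sup>2 = 4 * a * c - b\<^sup>2"
    using disc by (auto simp: s_def)
  define f where "f = (\<lambda>x. 1 / (a * x\<^sup>2 + b * x + c))"
  define F where "F = (\<lambda>x. 2 / s * arctan ((2 * a * x + b) / s))"
  have square: "4 * a * (a * x\<^sup>2 + b * x + c) = (2 * a * x + b)\<^sup>2 + s\<^sup>2" for x
    unfolding s2 by (simp add: power2_eq_square algebra_simps)
  have q_pos: "a * x\<^sup>2 + b * x + c > 0" for x
  proof -
    have "4 * a * (a * x\<^sup>2 + b * x + c) > 0"
      unfolding square using s by (simp add: add_nonneg_pos)
    then show ?thesis using a by (simp add: zero_less_mult_iff)
  qed
  have deriv: "(F has_real_derivative f x) (at x)" for x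
  proof -
    have "(F has_real_derivative 2 / s * (inverse (1 + ((2 * a * x + b) / s)\<^sup>2) * (2 * a / s))) (at x)"
      unfolding F_def by (rule derivative_eq_intros refl | use s in simp)+
    also have "2 / s * (inverse (1 + ((2 * a * x + b) / s)\<^sup>2) * (2 * a / s))
        = 4 * a / (s\<^sup>2 * (1 + ((2 * a * x + b) / s)\<^sup>2))"
      by (simp add: divide_simps power2_eq_square)
    also have "s\<^sup>2 * (1 + ((2 * a * x + b) / s)\<^sup>2) = 4 * a * (a * x\<^sup>2 + b * x + c)"
      unfolding square using s by (simp add: power_divide algebra_simps)
    also have "4 * a / (4 * a * (a * x\<^sup>2 + b * x + c)) = f x"
      using a by (simp add: f_def)
    finally show ?thesis .
  qed
  have cont: "isCont f x" for x
    unfolding f_def using q_pos[of x] by (intro continuous_intros) auto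
  have "filterlim (\<lambda>x. (2 * a * x + b) / s) at_top at_top"
    using a s by real_asymp
  then have "(F \<longlongrightarrow> 2 / s * (pi / 2)) at_top"
    unfolding F_def by (intro tendsto_intros filterlim_compose[OF tendsto_arctan_at_top])
  then have top: "((F \<circ> real_of_ereal) \<longlongrightarrow> pi / s) (at_left \<infinity>)"
    by (simp add: ereal_tendsto_simps)
  have "filterlim (\<lambda>x. (2 * a * x + b) / s) at_bot at_bot"
    using a s by real_asymp
  then have "(F \<longlongrightarrow> 2 / s * (- (pi / 2))) at_bot"
    unfolding F_def by (intro tendsto_intros filterlim_compose[OF tendsto_arctan_at_bot])
  then have bot: "((F \<circ> real_of_ereal) \<longlongrightarrow> - (pi / s)) (at_right (- \<infinity>))"
    by (simp add: ereal_tendsto_simps)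
  have f_nonneg: "0 \<le> f x" for x
    unfolding f_def using q_pos[of x] by simp
  have "set_integrable lborel (einterval (- \<infinity>) \<infinity>) f"
    and "(LBINT x=-\<infinity>..\<infinity>. f x) = pi / s - - (pi / s)"
    using interval_integral_FTC_nonneg[of "- \<infinity>" \<infinity> F f "- (pi / s)" "pi / s"]
      deriv cont f_nonneg bot top by auto
  then have "integrable lborel f" and "integral\<^sup>L lborel f = 2 * pi / s"
    by (simp_all add: set_integrable_def interval_lebesgue_integral_def set_lebesgue_integral_def)
  then show ?thesis
    by (simp add: has_bochner_integral_iff f_def s_def)
qed

lemma has_integral_inverse_quadratic:
  fixes a b c :: real
  assumes disc: "4 * a * c - b\<^sup>2 > 0"
  shows "has_bochner_integral lborel (\<lambda>x. 1 / (a * x\<^sup>2 + b * x + c))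
    (sgn a * (2 * pi / sqrt (4 * a * c - b\<^sup>2)))"
proof (cases "a > 0")
  case True
  then show ?thesis
    using has_integral_inverse_quadratic_pos[OF disc] by simp
next
  case False
  have "a \<noteq> 0" using disc by auto
  with False have a: "a < 0" by simp
  have "has_bochner_integral lborel (\<lambda>x. - (1 / (- a * x\<^sup>2 + - b * x + - c)))
      (- (2 * pi / sqrt (4 * (- a) * (- c) - (- b)\<^sup>2)))"
    using disc a by (intro has_bochner_integral_minus has_integral_inverse_quadratic_pos) auto
  moreover have "- (1 / (- a * x\<^sup>2 + - b * x + - c)) = 1 / (a * x\<^sup>2 + b * x + c)" for x
  proof -
    have "- a * x\<^sup>2 + - b * x + - c = - (a * x\<^sup>2 + b * x + c)" by simp
    then show ?thesis by (simp only: divide_minus_right minus_minus)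
  qed
  ultimately show ?thesis using a by simp
qed

text \<open>
  The sign of \<open>a\<close> survives because \<open>3 b\<^sup>2 < 12 a c\<close> and \<open>(a + 3 c)\<^sup>2 - 12 a c = (a - 3 c)\<^sup>2\<close>, so that
  \<open>a\<close> is multiplied by a positive factor.
\<close>

lemma landen_invariants:
  fixes a b c :: real
  assumes disc: "4 * a * c - b\<^sup>2 > 0" and step: "(a', b', c') = landen (a, b, c)"
  shows "4 * a' * c' - b'\<^sup>2 = 4 * a * c - b\<^sup>2" and "sgn a' = sgn a"
proof -
  define D where "D = landen_denom a b c"
  have a': "a' = a * (((a + 3 * c)\<^sup>2 - 3 * b\<^sup>2) / D)"
    and b': "b' = b * ((3 * (a - c)\<^sup>2 - b\<^sup>2) / D)"
    and c': "c' = c * (((3 * a + c)\<^sup>2 - 3 * b\<^sup>2) / D)"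
    using step by (auto simp: landen_def D_def)
  have D_eq: "D = 3 * (a + c)\<^sup>2 + (4 * a * c - b\<^sup>2)"
    unfolding D_def landen_denom_def by (simp add: power2_eq_square algebra_simps)
  have D: "D > 0"
    unfolding D_eq using disc by (simp add: add_nonneg_pos)
  have "(4 * a' * c' - b'\<^sup>2) * D\<^sup>2
      = 4 * (a * ((a + 3 * c)\<^sup>2 - 3 * b\<^sup>2)) * (c * ((3 * a + c)\<^sup>2 - 3 * b\<^sup>2))
        - (b * (3 * (a - c)\<^sup>2 - b\<^sup>2))\<^sup>2"
    unfolding a' b' c' using D by (simp add: field_simps power2_eq_square)
  also have "\<dots> = (4 * a * c - b\<^sup>2) * D\<^sup>2"
    unfolding D_eq by algebra
  finally show "4 * a' * c' - b'\<^sup>2 = 4 * a * c - b\<^sup>2"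
    using D by simp
  have "(a + 3 * c)\<^sup>2 - 3 * b\<^sup>2 = (a - 3 * c)\<^sup>2 + 3 * (4 * a * c - b\<^sup>2)"
    by (simp add: power2_eq_square algebra_simps)
  also have "\<dots> > 0"
    using disc by (simp add: add_nonneg_pos)
  finally have "((a + 3 * c)\<^sup>2 - 3 * b\<^sup>2) / D > 0"
    using D by simp
  then show "sgn a' = sgn a"
    unfolding a' sgn_mult[of a] by (simp only: sgn_pos mult_1_right)
qed

theorem mainTheorem1:
  fixes a b c :: real and A B C :: "nat \<Rightarrow> real"
  assumes "4 * a * c - b\<^sup>2 > 0"
    and "A 0 = a" and "B 0 = b" and "C 0 = c"
    and "\<And>n. (A (Suc n), B (Suc n), C (Suc n)) = landen (A n, B n, C n)"
  shows "\<forall>n. integrable lborel (\<lambda>x::real. 1 / (A n * x\<^sup>2 + B n * x + C n))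
           \<and> integrable lborel (\<lambda>x::real. 1 / (A (Suc n) * x\<^sup>2 + B (Suc n) * x + C (Suc n)))
           \<and> (LINT x|lborel. 1 / (A (Suc n) * x\<^sup>2 + B (Suc n) * x + C (Suc n)))
             = (LINT x|lborel. 1 / (A n * x\<^sup>2 + B n * x + C n))"
proof -
  have inv: "4 * A n * C n - (B n)\<^sup>2 = 4 * a * c - b\<^sup>2 \<and> sgn (A n) = sgn a" for n
  proof (induction n)
    case 0
    show ?case using assms(2-4) by simp
  next
    case (Suc n)
    then show ?case
      using landen_invariants[OF _ assms(5)[of n]] assms(1) by simp
  qed
  have "has_bochner_integral lborel (\<lambda>x. 1 / (A n * x\<^sup>2 + B n * x + C n))
      (sgn a * (2 * pi / sqrt (4 * a * c - b\<^sup>2)))" for n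
    using has_integral_inverse_quadratic[of "A n" "C n" "B n"] inv[of n] assms(1) by simp
  then show ?thesis
    by (simp add: has_bochner_integral_iff)
qed

end
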